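(* Let $\mathbf{d}=(d_1,\dots,d_n)$ be a multigraphical sequence. Then $\mathbf{d}$ admits a loopless multigraph realization containing two spanning trees that share at most one edge if and only if $\sum_{i=1}^n d_i\ge 4(n-1)-2$ and either (a) $n\le 2$, or (b) $n>2$, $d_{n-1}\ge 2$ and $d_n\ge 1$.
   Context: A degree sequence is non-increasing, $d_1\ge\dots\ge d_n\ge 0$; it is multigraphical if some loopless multigraph (parallel edges allowed) on $v_1,\dots,v_n$ has $\deg(v_i)=d_i$ (a realization). A spanning tree of a multigraph is a set of edges (specific parallel copies) forming a tree containing all vertices; two spanning trees share at most one edge if at most one edge (copy) belongs to both. *)

theory Defs
  imports Main
begin

text \<open>Every edge is an individual copy \<open>e\<close> with its set of end vertices \<open>mends G e\<close>,
  so parallel edges are distinct elements of \<open>medges G\<close>. For a vertex set \<open>{1..n}\<close> and finitely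
  many edges, labelling the edges by natural numbers is no restriction; the existential
  statements below range over such graphs.\<close>

record ('v, 'e) multigraph =
  mverts :: "'v set"
  medges :: "'e set"
  mends :: "'e \<Rightarrow> 'v set"

definition loopless_multigraph :: "('v, 'e) multigraph \<Rightarrow> bool" where
  "loopless_multigraph G \<longleftrightarrow> finite (mverts G) \<and> finite (medges G) \<and>
     (\<forall>e\<in>medges G. mends G e \<subseteq> mverts G \<and> card (mends G e) = 2)"

definition mdegree :: "('v, 'e) multigraph \<Rightarrow> 'v \<Rightarrow> nat" where
  "mdegree G v = card {e \<in> medges G. v \<in> mends G e}"

definition madj :: "('v, 'e) multigraph \<Rightarrow> ('v \<times> 'v) set" where
  "madj G = {(u, v). \<exists>e\<in>medges G. mends G e = {u, v}}"

definition mconnected :: "('v, 'e) multigraph \<Rightarrow> bool" where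
  "mconnected G \<longleftrightarrow> mverts G \<noteq> {} \<and> (\<forall>u\<in>mverts G. \<forall>v\<in>mverts G. (u, v) \<in> (madj G)\<^sup>*)"

text \<open>Two parallel edges form a cycle of length 2.\<close>

definition mcycle :: "('v, 'e) multigraph \<Rightarrow> 'v list \<Rightarrow> 'e list \<Rightarrow> bool" where
  "mcycle G vs es \<longleftrightarrow> vs \<noteq> [] \<and> length es = length vs \<and> distinct vs \<and> distinct es \<and>
     set vs \<subseteq> mverts G \<and> set es \<subseteq> medges G \<and>
     (\<forall>i<length vs. mends G (es ! i) = {vs ! i, vs ! (Suc i mod length vs)})"

definition mtree :: "('v, 'e) multigraph \<Rightarrow> bool" where
  "mtree G \<longleftrightarrow> mconnected G \<and> (\<nexists>vs es. mcycle G vs es)"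

definition spanning_tree :: "('v, 'e) multigraph \<Rightarrow> 'e set \<Rightarrow> bool" where
  "spanning_tree G T \<longleftrightarrow> T \<subseteq> medges G \<and> mtree (G\<lparr>medges := T\<rparr>)"

text \<open>A sequence \<open>d\<^sub>1, \<dots>, d\<^sub>n\<close> is the restriction of \<open>d\<close> to \<open>{1..n}\<close>;
  the vertex \<open>v\<^sub>i\<close> is the number \<open>i\<close>.\<close>

definition degree_sequence :: "nat \<Rightarrow> (nat \<Rightarrow> nat) \<Rightarrow> bool" where
  "degree_sequence n d \<longleftrightarrow> (\<forall>i\<in>{1..n}. \<forall>j\<in>{1..n}. i \<le> j \<longrightarrow> d j \<le> d i)"

definition realization :: "(nat, 'e) multigraph \<Rightarrow> nat \<Rightarrow> (nat \<Rightarrow> nat) \<Rightarrow> bool" where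
  "realization G n d \<longleftrightarrow> loopless_multigraph G \<and> mverts G = {1..n} \<and>
     (\<forall>i\<in>{1..n}. mdegree G i = d i)"

definition multigraphical :: "nat \<Rightarrow> (nat \<Rightarrow> nat) \<Rightarrow> bool" where
  "multigraphical n d \<longleftrightarrow> degree_sequence n d \<and>
     (\<exists>G :: (nat, nat) multigraph. realization G n d)"

end

theory Submission
  imports Defs
begin

text \<open>
  Necessity: a connected multigraph on \<open>n\<close> vertices has at least \<open>n - 1\<close> edges, so
  \<open>S \<union> T\<close> has at least \<open>2 (n - 1) - 1\<close> edges. Every vertex meets both trees, and two vertices
  of degree 1 would give two common edges, or one common edge forming a whole component.

  Sufficiency, for \<open>n > 2\<close> and \<open>\<Sum> d = 4 (n - 1) - 2\<close>: let \<open>x\<close> be a vertex of minimum degree and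
  split \<open>d = a + b\<close> with \<open>a x = d x\<close>, \<open>b x = 0\<close>, and both parts positive at every other vertex,
  such that \<open>a\<close> is a tree degree sequence on all vertices. Then \<open>b\<close> is one on the vertices other
  than \<open>x\<close>. The union of the two trees realizes \<open>d\<close>, and the second tree becomes spanning by
  adding an edge of the first tree at \<open>x\<close>, the only edge shared. A larger sum is reduced to this
  one by deleting edges between the two vertices of largest degree.
\<close>

section \<open>Trees grown leaf by leaf\<close>

text \<open>Leaf attachment gives inductions that peel off one leaf. The end map \<open>f\<close> is
  unconstrained outside \<open>E\<close>, so several trees can share the end map of one
  multigraph.\<close>

inductive leaf_tree :: "('e \<Rightarrow> 'v set) \<Rightarrow> 'v set \<Rightarrow> 'e set \<Rightarrow> bool" for f where
  single: "leaf_tree f {v} {}"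
| leaf: "leaf_tree f V E \<Longrightarrow> u \<in> V \<Longrightarrow> v \<notin> V \<Longrightarrow> e \<notin> E \<Longrightarrow> f e = {u, v} \<Longrightarrow>
    leaf_tree f (insert v V) (insert e E)"

lemma leaf_tree_basic:
  assumes "leaf_tree f V E"
  shows "finite V" "finite E" "card V = Suc (card E)" "\<forall>e\<in>E. f e \<subseteq> V \<and> card (f e) = 2"
proof -
  have "finite V \<and> finite E \<and> card V = Suc (card E) \<and> (\<forall>e\<in>E. f e \<subseteq> V \<and> card (f e) = 2)"
    using assms
  proof induction
    case (leaf V E u v e)
    then have "u \<noteq> v" by auto
    with leaf show ?case by auto
  qed auto
  then show "finite V" "finite E" "card V = Suc (card E)"
    "\<forall>e\<in>E. f e \<subseteq> V \<and> card (f e) = 2" by auto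
qed

lemma leaf_tree_cong:
  assumes "leaf_tree f V E" "\<And>e. e \<in> E \<Longrightarrow> g e = f e"
  shows "leaf_tree g V E"
  using assms
proof induction
  case (leaf V E u v e)
  then show ?case by (intro leaf_tree.leaf[of g V E u v e]) auto
qed (rule leaf_tree.single)

section \<open>Leaf trees are acyclic and connected\<close>

lemma mcycle_two_edges:
  assumes cyc: "mcycle G vs es" and v: "v \<in> set vs" and ne: "\<And>e. e \<in> medges G \<Longrightarrow> mends G e \<noteq> {v}"
  shows "\<exists>e\<in>set es. \<exists>e'\<in>set es. e \<noteq> e' \<and> v \<in> mends G e \<and> v \<in> mends G e'"
proof -
  let ?n = "length vs"
  from cyc have len: "length es = ?n" and de: "distinct es" and sub: "set es \<subseteq> medges G"
    and ends: "\<And>i. i < ?n \<Longrightarrow> mends G (es ! i) = {vs ! i, vs ! (Suc i mod ?n)}"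
    unfolding mcycle_def by auto
  from v obtain i where i: "i < ?n" "vs ! i = v" by (auto simp: in_set_conv_nth)
  \<comment> \<open>\<open>j\<close> is the cyclic predecessor of \<open>i\<close>, so edges
    \<open>i\<close> and \<open>j\<close> both meet \<open>v\<close>. They coincide only on a cycle
    of length 1, which would be a loop at \<open>v\<close>.\<close>
  define j where "j = (if i = 0 then ?n - 1 else i - 1)"
  have j: "j < ?n" "Suc j mod ?n = i" using i unfolding j_def by auto
  have "?n \<noteq> 1"
  proof
    assume "?n = 1"
    with i have "mends G (es ! 0) = {v}" using ends[of 0] by auto
    moreover have "es ! 0 \<in> medges G" using len sub \<open>?n = 1\<close> by (metis less_one nth_mem subsetD)
    ultimately show False using ne by blast
  qed
  then have "j \<noteq> i" using i unfolding j_def by auto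
  then have "es ! i \<noteq> es ! j" using de i j len by (simp add: nth_eq_iff_index_eq)
  moreover have "v \<in> mends G (es ! i)" "v \<in> mends G (es ! j)" using ends i j by auto
  ultimately show ?thesis using i j len by (metis nth_mem)
qed

text \<open>The new leaf \<open>v\<close> meets only \<open>e\<close>, so no cycle passes through
  \<open>v\<close>; a cycle avoiding \<open>v\<close> also avoids \<open>e\<close> and thus lies in
  the smaller tree.\<close>

lemma leaf_tree_acyclic:
  assumes "leaf_tree f V E"
  shows "\<not> mcycle \<lparr>mverts = V, medges = E, mends = f\<rparr> vs es"
  using assms
proof (induction)
  case (single v)
  then show ?case by (auto simp: mcycle_def)
next
  case (leaf V E u v e)
  let ?G = "\<lparr>mverts = insert v V, medges = insert e E, mends = f\<rparr>"
  note basic = leaf_tree_basic[OF leaf.hyps(1)]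
  have uv: "u \<noteq> v" using leaf.hyps by auto
  have only: "e' = e" if "e' \<in> insert e E" "v \<in> f e'" for e'
    using that basic leaf.hyps(3) by auto
  show ?case
  proof
    assume cyc: "mcycle ?G vs es"
    then have es: "set es \<subseteq> insert e E" by (auto simp: mcycle_def)
    show False
    proof (cases "v \<in> set vs")
      case True
      have "f e' \<noteq> {v}" if "e' \<in> insert e E" for e'
        using that only[of e'] leaf.hyps(5) uv by auto
      with mcycle_two_edges[OF cyc True] obtain e1 e2 where
        "e1 \<in> set es" "e2 \<in> set es" "e1 \<noteq> e2" "v \<in> f e1" "v \<in> f e2" by auto
      with es only show False by blast
    next
      case False
      have "e \<notin> set es"
      proof
        assume "e \<in> set es"
        then obtain i where i: "i < length es" "es ! i = e" by (auto simp: in_set_conv_nth)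
        with cyc have "f e = {vs ! i, vs ! (Suc i mod length vs)}" "i < length vs"
          by (auto simp: mcycle_def)
        then have "f e \<subseteq> set vs"
          by (metis empty_subsetI insert_subset less_nat_zero_code mod_less_divisor neq0_conv nth_mem)
        with leaf.hyps(5) False show False by auto
      qed
      with False cyc have "mcycle \<lparr>mverts = V, medges = E, mends = f\<rparr> vs es"
        by (auto simp: mcycle_def)
      with leaf.IH show False by blast
    qed
  qed
qed

lemma madj_sym: "(u, v) \<in> madj G \<Longrightarrow> (v, u) \<in> madj G"
  by (auto simp: madj_def insert_commute)

lemma leaf_tree_connected:
  assumes "leaf_tree f V E"
  shows "mconnected \<lparr>mverts = V, medges = E, mends = f\<rparr>"
  using assms
proof (induction)
  case (single v)
  then show ?case by (auto simp: mconnected_def)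
next
  case (leaf V E u v e)
  let ?G = "\<lparr>mverts = V, medges = E, mends = f\<rparr>"
  let ?H = "\<lparr>mverts = insert v V, medges = insert e E, mends = f\<rparr>"
  have "madj ?G \<subseteq> madj ?H" by (auto simp: madj_def)
  then have mono: "(madj ?G)\<^sup>* \<subseteq> (madj ?H)\<^sup>*" by (rule rtrancl_mono)
  have old: "(p, q) \<in> (madj ?H)\<^sup>*" if "p \<in> V" "q \<in> V" for p q
    using leaf.IH that mono by (auto simp: mconnected_def)
  have uv: "(u, v) \<in> madj ?H" using leaf.hyps by (auto simp: madj_def)
  then have vu: "(v, u) \<in> madj ?H" by (rule madj_sym)
  have 1: "(p, v) \<in> (madj ?H)\<^sup>*" if "p \<in> V" for p
    using old[OF that leaf.hyps(2)] uv by (rule rtrancl_into_rtrancl)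
  have 2: "(v, p) \<in> (madj ?H)\<^sup>*" if "p \<in> V" for p
    using vu old[OF leaf.hyps(2) that] by (rule converse_rtrancl_into_rtrancl)
  show ?case using old 1 2 by (auto simp: mconnected_def)
qed

lemma leaf_tree_spanning_tree:
  assumes "leaf_tree f V S" "S \<subseteq> E"
  shows "spanning_tree \<lparr>mverts = V, medges = E, mends = f\<rparr> S"
  using leaf_tree_connected[OF assms(1)] leaf_tree_acyclic[OF assms(1)] assms(2)
  by (simp add: spanning_tree_def mtree_def)

section \<open>Degree sequences of trees\<close>

text \<open>Induction on the number of vertices: delete a vertex of degree 1 and lower the degree of
  its future neighbour. \<open>F\<close> holds forbidden labels, which later keeps two trees
  edge-disjoint. A single vertex has degree 0, hence the guarded positivity.\<close>

lemma leaf_tree_with_degrees: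
  fixes V :: "'v set" and F :: "'e set"
  assumes "infinite (UNIV :: 'e set)" "finite V" "finite F" "V \<noteq> {}"
    and "sum a V = 2 * (card V - 1)" "card V > 1 \<Longrightarrow> \<forall>v\<in>V. a v \<ge> 1"
  shows "\<exists>f E. leaf_tree f V E \<and> E \<inter> F = {} \<and> (\<forall>v\<in>V. card {e\<in>E. v \<in> f e} = a v)"
  using assms(2,4-6)
proof (induction "card V" arbitrary: V a)
  case 0
  then show ?case by simp
next
  case (Suc m)
  show ?case
  proof (cases "m = 0")
    case True
    with Suc.hyps obtain v where "V = {v}" by (metis One_nat_def card_1_singletonE)
    with Suc.prems show ?thesis
      by (intro exI[of _ "\<lambda>_. {}"] exI[of _ "{}"]) (auto intro: leaf_tree.single)
  next
    case False
    then have c2: "card V \<ge> 2" and pos: "\<forall>v\<in>V. a v \<ge> 1" using Suc by auto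
    have "\<exists>v\<in>V. a v = 1"
    proof (rule ccontr)
      assume "\<not> ?thesis"
      with pos have "\<forall>v\<in>V. a v \<ge> 2" by (metis Suc_1 Suc_leI le_neq_implies_less)
      then have "(\<Sum>v\<in>V. 2) \<le> sum a V" by (intro sum_mono) auto
      with Suc.prems(3) c2 show False by simp
    qed
    then obtain v where v: "v \<in> V" "a v = 1" by blast
    define W where "W = V - {v}"
    have W: "finite W" "v \<notin> W" "insert v W = V" "card W = m"
      using Suc.prems(1) Suc.hyps(2) v unfolding W_def by auto
    have sumW: "sum a W = 2 * card W - 1"
      using Suc.prems(1,3) v W sum.remove[of V v a] Suc.hyps(2) by (auto simp: W_def)
    \<comment> \<open>The neighbour must keep a positive degree after losing 1, unless it is the
      only vertex left. If all degrees on \<open>W\<close> were at most 1, then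
      \<open>2 * card W - 1 \<le> card W\<close>, so \<open>card W \<le> 1\<close>.\<close>
    have "\<exists>u\<in>W. card W > 1 \<longrightarrow> a u \<ge> 2"
    proof (rule ccontr)
      assume *: "\<not> ?thesis"
      moreover have "W \<noteq> {}" using W False by auto
      ultimately have "card W > 1" "\<forall>u\<in>W. a u \<le> 1" by auto
      then have "sum a W \<le> (\<Sum>v\<in>W. 1)" by (intro sum_mono) auto
      with sumW \<open>card W > 1\<close> show False by simp
    qed
    then obtain u where u: "u \<in> W" "card W > 1 \<longrightarrow> a u \<ge> 2" by blast
    have u1: "a u \<ge> 1" using pos u W by auto
    define a' where "a' = a(u := a u - 1)"
    have "sum a' W = a' u + sum a' (W - {u})" using W u by (simp add: sum.remove)
    also have "sum a' (W - {u}) = sum a (W - {u})" by (rule sum.cong) (auto simp: a'_def)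
    finally have "sum a' W + 1 = sum a W"
      using W u u1 sum.remove[of W u a] by (simp add: a'_def)
    then have s': "sum a' W = 2 * (card W - 1)" using sumW by auto
    have p': "\<forall>v\<in>W. a' v \<ge> 1" if "card W > 1" using that u pos W by (auto simp: a'_def)
    have "W \<noteq> {}" using u by auto
    from Suc.hyps(1)[OF W(4)[symmetric] W(1) this s' p'] obtain f E where
      f: "leaf_tree f W E" "E \<inter> F = {}" "\<forall>v\<in>W. card {e\<in>E. v \<in> f e} = a' v" by blast
    note basic = leaf_tree_basic[OF f(1)]
    have "finite (E \<union> F)" using basic assms(3) by simp
    with assms(1) obtain e where e: "e \<notin> E" "e \<notin> F" by (metis UnCI ex_new_if_finite)
    define g where "g = f(e := {u, v})"
    have g: "\<And>e'. e' \<in> E \<Longrightarrow> g e' = f e'" "g e = {u, v}" using e by (auto simp: g_def)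
    have "leaf_tree g V (insert e E)"
      using leaf_tree.leaf[OF leaf_tree_cong[OF f(1), of g] u(1) W(2) e(1)] g W(3) by auto
    moreover have "insert e E \<inter> F = {}" using e f by auto
    moreover have "card {e'\<in>insert e E. w \<in> g e'} = a w" if "w \<in> V" for w
    proof (cases "w = v")
      case True
      then have "{e'\<in>insert e E. w \<in> g e'} = {e}" using g basic(4) W(2) by blast
      with True v show ?thesis by simp
    next
      case False
      then have w: "w \<in> W" using that W by auto
      show ?thesis
      proof (cases "w = u")
        case True
        then have "{e'\<in>insert e E. w \<in> g e'} = insert e {e'\<in>E. w \<in> f e'}" using g by auto
        with True w f(3) e basic u1 show ?thesis by (auto simp: a'_def)
      next
        case nu: False
        then have "{e'\<in>insert e E. w \<in> g e'} = {e'\<in>E. w \<in> f e'}" using g False by auto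
        with nu w f(3) show ?thesis by (auto simp: a'_def)
      qed
    qed
    ultimately show ?thesis by blast
  qed
qed

lemma intermediate_sum:
  fixes lo hi :: "'a \<Rightarrow> nat"
  assumes "finite W" "\<And>v. v \<in> W \<Longrightarrow> lo v \<le> hi v" "sum lo W \<le> m" "m \<le> sum hi W"
  shows "\<exists>a. (\<forall>v\<in>W. lo v \<le> a v \<and> a v \<le> hi v) \<and> sum a W = m"
  using assms
proof (induction arbitrary: m rule: finite_induct)
  case empty
  then show ?case by simp
next
  case (insert x W)
  \<comment> \<open>The least value at \<open>x\<close> whose remainder the upper bounds on
    \<open>W\<close> can absorb; the truncated difference is 0 when they absorb all of
    \<open>m\<close>.\<close>
  define k where "k = max (lo x) (m - sum hi W)"
  have k: "lo x \<le> k" "k \<le> hi x" "k \<le> m" "sum lo W \<le> m - k" "m - k \<le> sum hi W"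
    using insert.prems insert.hyps sum_mono[of W lo hi] by (auto simp: k_def)
  have "\<exists>a. (\<forall>v\<in>W. lo v \<le> a v \<and> a v \<le> hi v) \<and> sum a W = m - k"
    using insert.prems(1) k by (intro insert.IH) auto
  then obtain a where a: "\<forall>v\<in>W. lo v \<le> a v \<and> a v \<le> hi v" "sum a W = m - k" by blast
  have "sum (a(x := k)) W = sum a W" using insert.hyps by (intro sum.cong) auto
  with a k insert.hyps show ?case by (intro exI[of _ "a(x := k)"]) auto
qed

section \<open>Realizations with two almost disjoint spanning trees\<close>

text \<open>The vertex set is arbitrary and carries no order, so degrees can be lowered in an
  induction without sorting them again.\<close>

definition two_tree_realizable :: "'v set \<Rightarrow> ('v \<Rightarrow> nat) \<Rightarrow> bool" where
  "two_tree_realizable V d \<longleftrightarrow> (\<exists>(f :: nat \<Rightarrow> 'v set) E S T. finite E \<and>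
     (\<forall>e\<in>E. f e \<subseteq> V \<and> card (f e) = 2) \<and> (\<forall>v\<in>V. card {e\<in>E. v \<in> f e} = d v) \<and>
     S \<subseteq> E \<and> T \<subseteq> E \<and> leaf_tree f V S \<and> leaf_tree f V T \<and> card (S \<inter> T) \<le> 1)"

text \<open>The sum splits as \<open>2 * (card V - 1) + 2 * (card V - 2)\<close>, the degree sums of
  a tree on \<open>V\<close> and of a tree on \<open>V - {x}\<close>.\<close>

lemma two_tree_realizable_tight:
  fixes V :: "'v set"
  assumes V: "finite V" "card V \<ge> 3" and x: "x \<in> V" "1 \<le> d x" "d x < card V"
    and ge2: "\<forall>v\<in>V - {x}. d v \<ge> 2" and sum: "sum d V = 4 * card V - 6"
  shows "two_tree_realizable V d"
proof -
  let ?n = "card V"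
  define W where "W = V - {x}"
  have cW: "card W = ?n - 1" using V x by (simp add: W_def)
  then have "card W \<noteq> 0" using V by simp
  then have "W \<noteq> {}" by auto
  with cW have W: "finite W" "x \<notin> W" "insert x W = V" "card W = ?n - 1" "W \<noteq> {}"
    using V x by (auto simp: W_def)
  have dW: "\<forall>v\<in>W. d v \<ge> 2" using ge2 W_def by auto
  have sW: "d x + sum d W = 4 * ?n - 6" using sum W sum.insert[of W x d] by simp
  have "(\<Sum>v\<in>W. d v - 1) + card W = (\<Sum>v\<in>W. (d v - 1) + 1)"
    by (simp only: sum.distrib card_eq_sum)
  also have "\<dots> = sum d W" using dW by (intro sum.cong) auto
  finally have hi: "(\<Sum>v\<in>W. d v - 1) = sum d W - (?n - 1)" using W(4) by simp
  \<comment> \<open>The bounds leave each tree a positive share at \<open>v\<close>. The target plus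
    \<open>d x\<close> is \<open>2 * (?n - 1)\<close>; it is at least \<open>card W\<close> because
    \<open>d x < ?n\<close>, and at most the sum of the upper bounds because
    \<open>?n \<ge> 3\<close>.\<close>
  have "\<exists>a. (\<forall>v\<in>W. 1 \<le> a v \<and> a v \<le> d v - 1) \<and> sum a W = 2 * ?n - 2 - d x"
  proof (rule intermediate_sum[OF W(1)])
    show "1 \<le> d v - 1" if "v \<in> W" for v using dW that by fastforce
  qed (use hi sW W(4) V x in auto)
  then obtain a0 where a0: "\<And>v. v \<in> W \<Longrightarrow> 1 \<le> a0 v \<and> a0 v \<le> d v - 1"
    "sum a0 W = 2 * ?n - 2 - d x" by blast
  define a where "a = a0(x := d x)"
  have aW: "sum a W = sum a0 W" using W(2) by (intro sum.cong) (auto simp: a_def)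
  have "sum a V = d x + sum a W" using W sum.insert[of W x a] by (simp add: a_def)
  then have sa: "sum a V = 2 * (?n - 1)" using aW a0(2) x by simp
  have pa: "\<forall>v\<in>V. a v \<ge> 1" using a0(1) x W by (auto simp: a_def)
  have "V \<noteq> {}" using x by auto
  then obtain f1 and E1 :: "nat set" where 1: "leaf_tree f1 V E1" "\<forall>v\<in>V. card {e\<in>E1. v \<in> f1 e} = a v"
    using leaf_tree_with_degrees[of V "{} :: nat set" a] V sa pa by auto
  note b1 = leaf_tree_basic[OF 1(1)]
  have alt: "a v \<le> d v - 1" "d v \<ge> 2" if "v \<in> W" for v using that a0(1) W(2) dW by (auto simp: a_def)
  have "(\<Sum>v\<in>W. d v - a v) = sum d W - sum a W"
    using alt by (intro sum_subtractf_nat) fastforce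
  then have sb: "(\<Sum>v\<in>W. d v - a v) = 2 * (card W - 1)" using aW a0(2) sW W(4) x V by simp
  have pb: "\<forall>v\<in>W. d v - a v \<ge> 1" using alt by fastforce
  \<comment> \<open>Forbidding the labels in \<open>E1\<close> makes the trees edge-disjoint, so the
    two end maps can be glued into one.\<close>
  obtain f2 E2 where 2: "leaf_tree f2 W E2" "E2 \<inter> E1 = {}"
    "\<forall>v\<in>W. card {e\<in>E2. v \<in> f2 e} = d v - a v"
    using leaf_tree_with_degrees[of W E1 "\<lambda>v. d v - a v"] W sb pb b1 by auto
  note b2 = leaf_tree_basic[OF 2(1)]
  define f where "f = (\<lambda>e. if e \<in> E1 then f1 e else f2 e)"
  have f1: "\<And>e. e \<in> E1 \<Longrightarrow> f e = f1 e" and f2: "\<And>e. e \<in> E2 \<Longrightarrow> f e = f2 e"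
    using 2(2) by (auto simp: f_def)
  \<comment> \<open>An edge of the first tree at \<open>x\<close> also hangs \<open>x\<close> as a
    leaf on the second tree; reusing it leaves all degrees unchanged.\<close>
  have "card {e\<in>E1. x \<in> f1 e} > 0" using 1(2) x pa by fastforce
  then obtain e0 where e0: "e0 \<in> E1" "x \<in> f1 e0" by (auto simp: card_gt_0_iff)
  have e0': "f1 e0 \<subseteq> V" "card (f1 e0) = 2" using b1 e0 by auto
  then obtain y where y: "f1 e0 = {y, x}" "y \<noteq> x" using e0(2)
    by (metis card_2_iff doubleton_eq_iff insert_iff singletonD)
  have t1: "leaf_tree f V E1" using 1(1) f1 by (rule leaf_tree_cong)
  have "leaf_tree f W E2" using 2(1) f2 by (rule leaf_tree_cong)
  then have "leaf_tree f (insert x W) (insert e0 E2)"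
    using y e0' W e0 2(2) f1 by (intro leaf_tree.leaf[of f W E2 y x e0]) auto
  then have t2: "leaf_tree f V (insert e0 E2)" using W by simp
  have deg: "card {e\<in>E1 \<union> E2. v \<in> f e} = d v" if v: "v \<in> V" for v
  proof -
    have "{e\<in>E1 \<union> E2. v \<in> f e} = {e\<in>E1. v \<in> f1 e} \<union> {e\<in>E2. v \<in> f2 e}" using f1 f2 by auto
    moreover have "{e\<in>E1. v \<in> f1 e} \<inter> {e\<in>E2. v \<in> f2 e} = {}" using 2(2) by auto
    ultimately have c: "card {e\<in>E1 \<union> E2. v \<in> f e} = a v + card {e\<in>E2. v \<in> f2 e}"
      using b1 b2 1(2) v by (simp add: card_Un_disjoint)
    show ?thesis
    proof (cases "v = x")
      case True
      then have none: "{e\<in>E2. v \<in> f2 e} = {}" using b2 W(2) by auto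
      show ?thesis using c True unfolding none by (simp add: a_def)
    next
      case False
      then have "v \<in> W" using v W by auto
      with c 2(3) alt[of v] show ?thesis by auto
    qed
  qed
  have "E1 \<inter> insert e0 E2 = {e0}" using 2(2) e0 by auto
  then have "card (E1 \<inter> insert e0 E2) \<le> 1" by simp
  moreover have "\<forall>e\<in>E1 \<union> E2. f e \<subseteq> V \<and> card (f e) = 2"
  proof
    fix e assume "e \<in> E1 \<union> E2"
    then show "f e \<subseteq> V \<and> card (f e) = 2"
    proof
      assume "e \<in> E1"
      with f1 b1(4) show ?thesis by simp
    next
      assume "e \<in> E2"
      with f2 b2(4) have "f e \<subseteq> W" "card (f e) = 2" by simp_all
      then show ?thesis by (auto simp: W_def)
    qed
  qed
  moreover have "finite (E1 \<union> E2)" "E1 \<subseteq> E1 \<union> E2" "insert e0 E2 \<subseteq> E1 \<union> E2"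
    using b1 b2 e0 by auto
  ultimately show ?thesis unfolding two_tree_realizable_def using t1 t2 deg
    by (intro exI[of _ f] exI[of _ "E1 \<union> E2"] exI[of _ E1] exI[of _ "insert e0 E2"] conjI ballI) simp_all
qed

section \<open>From the tight degree sum to larger ones\<close>

lemma two_tree_realizable_add_edge:
  assumes "two_tree_realizable V d'" "u \<in> V" "w \<in> V" "u \<noteq> w"
    and d: "\<And>v. v \<in> V \<Longrightarrow> d v = d' v + (if v = u \<or> v = w then 1 else 0)"
  shows "two_tree_realizable V d"
proof -
  from assms(1) obtain f :: "nat \<Rightarrow> 'a set" and E S T where
    E: "finite E" "\<forall>e\<in>E. f e \<subseteq> V \<and> card (f e) = 2" "\<forall>v\<in>V. card {e\<in>E. v \<in> f e} = d' v"
    and ST: "S \<subseteq> E" "T \<subseteq> E" "leaf_tree f V S" "leaf_tree f V T" "card (S \<inter> T) \<le> 1"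
    unfolding two_tree_realizable_def by blast
  obtain e where e: "e \<notin> E" using E(1) by (metis ex_new_if_finite infinite_UNIV_nat)
  define g where "g = f(e := {u, w})"
  have g: "\<And>e'. e' \<in> E \<Longrightarrow> g e' = f e'" "g e = {u, w}" using e by (auto simp: g_def)
  have "leaf_tree g V S" "leaf_tree g V T"
    using leaf_tree_cong[OF ST(3), of g] leaf_tree_cong[OF ST(4), of g] ST(1,2) g(1) by blast+
  moreover have "\<forall>e'\<in>insert e E. g e' \<subseteq> V \<and> card (g e') = 2" using E(2) g assms(2-4) by auto
  moreover have "card {e'\<in>insert e E. v \<in> g e'} = d v" if v: "v \<in> V" for v
  proof (cases "v = u \<or> v = w")
    case True
    then have "{e'\<in>insert e E. v \<in> g e'} = insert e {e'\<in>E. v \<in> f e'}" using g by auto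
    with True v d E e show ?thesis by simp
  next
    case False
    then have "{e'\<in>insert e E. v \<in> g e'} = {e'\<in>E. v \<in> f e'}" using g by auto
    with False v d E show ?thesis by simp
  qed
  moreover have "finite (insert e E)" "S \<subseteq> insert e E" "T \<subseteq> insert e E" using E ST by auto
  ultimately show ?thesis unfolding two_tree_realizable_def using ST(5) by blast
qed

text \<open>A lower bound of all degrees is at most their average. With \<open>n = card V\<close>,
  the bound \<open>n \<le> d x\<close> would give n^2 <= 4n - 6, but n^2 - 4n + 6 = (n - 2)^2 + 2 >
  0.\<close>

lemma min_vertex_degree_small:
  fixes d :: "'v \<Rightarrow> nat"
  assumes "finite V" "card V \<ge> 3" "\<forall>v\<in>V. d x \<le> d v" "sum d V = 4 * card V - 6"
  shows "d x < card V"
proof -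
  have "(\<Sum>v\<in>V. d x) \<le> sum d V" using assms by (intro sum_mono) auto
  then have le: "card V * d x \<le> 4 * card V - 6" using assms(4) by simp
  show ?thesis
  proof (rule ccontr)
    assume "\<not> ?thesis"
    then have c: "card V \<le> d x" by simp
    have "card V * card V \<le> card V * d x" using c by simp
    with le have sq: "card V * card V \<le> 4 * card V - 6" by linarith
    show False
    proof (cases "card V = 3")
      case False
      then have "4 * card V \<le> card V * card V" using assms(2) by (intro mult_le_mono1) simp
      with sq assms(2) show False by linarith
    qed (use sq in simp)
  qed
qed

text \<open>Induction on the number \<open>k\<close> of surplus edges. The bound
  \<open>2 * d v \<le> sum d V\<close> is the balance condition of loopless multigraphs and survives
  each deletion. The vertex \<open>x\<close> that may have degree 1 can change between steps, so it
  is generalized.\<close>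

lemma two_tree_realizable_sufficient:
  fixes V :: "'v set"
  assumes "finite V" "card V \<ge> 3" "x \<in> V" "1 \<le> d x" "\<forall>v\<in>V - {x}. d v \<ge> 2"
    "\<forall>v\<in>V. 2 * d v \<le> sum d V" "sum d V = 4 * card V - 6 + 2 * k"
  shows "two_tree_realizable V d"
  using assms(3-)
proof (induction k arbitrary: d x)
  case 0
  \<comment> \<open>Exchange \<open>x\<close> for a vertex of minimum degree, which is below
    \<open>card V\<close>; all others still have degree at least 2.\<close>
  obtain z where z: "z \<in> V" "\<forall>v\<in>V. d z \<le> d v"
    using arg_min_least[OF assms(1), of _ d] arg_min_if_finite(1)[OF assms(1), of d] 0(1) by blast
  have "1 \<le> d z" using z(1) 0 by force
  moreover have "\<forall>v\<in>V - {z}. d v \<ge> 2" using z 0 by (metis Diff_iff empty_iff insert_iff le_trans)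
  moreover have "d z < card V" using min_vertex_degree_small[OF assms(1,2) z(2)] 0 by simp
  ultimately show ?case using two_tree_realizable_tight assms(1,2) z(1) 0 by simp
next
  case (Suc k)
  have max: "\<exists>u\<in>A. \<forall>v\<in>A. d v \<le> d u" if "finite A" "A \<noteq> {}" for A
  proof -
    have "Max (d ` A) \<in> d ` A" using that by simp
    then obtain u where "u \<in> A" "d u = Max (d ` A)" by auto
    with that show ?thesis by (intro bexI[of _ u]) auto
  qed
  obtain u where u: "u \<in> V" "\<forall>v\<in>V. d v \<le> d u" using max[of V] assms(1) Suc.prems(1) by blast
  have cu: "card (V - {u}) = card V - 1" using u assms(1) by simp
  then have "V - {u} \<noteq> {}" using assms(2) by force
  then obtain w where w: "w \<in> V" "w \<noteq> u" "\<forall>v\<in>V - {u}. d v \<le> d w"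
    using max[of "V - {u}"] assms(1) by blast
  have su: "sum d V = d u + sum d (V - {u})" using u assms(1) by (simp add: sum.remove)
  \<comment> \<open>If \<open>w\<close> is \<open>x\<close>, a third vertex outside
    \<open>{u, x}\<close> has degree at least 2, and \<open>d w\<close> dominates it.\<close>
  have w2: "d w \<ge> 2"
  proof (cases "w = x")
    case True
    have "V - {u, x} \<noteq> {}"
    proof
      assume "V - {u, x} = {}"
      then have "card V \<le> card {u, x}" by (intro card_mono) auto
      with assms(2) show False by (auto simp: card_insert_if split: if_splits)
    qed
    then obtain v where v: "v \<in> V - {u, x}" by blast
    then have "2 \<le> d v" using Suc.prems(3) by blast
    also have "\<dots> \<le> d w" using v w(3) by blast
    finally show ?thesis .
  qed (use w Suc.prems(3) in auto)
  define d' where "d' = d(u := d u - 1, w := d w - 1)"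
  have du: "d u \<ge> 2" using u w w2 by force
  have dd': "d v = d' v + (if v = u \<or> v = w then 1 else 0)" for v
    using du w2 w by (auto simp: d'_def)
  have "sum d V = sum d' V + (\<Sum>v\<in>V. if v = u \<or> v = w then 1 else 0)"
    by (subst sum.distrib[symmetric]) (rule sum.cong[OF refl dd'])
  also have "(\<Sum>v\<in>V. if v = u \<or> v = w then 1 else 0) = card {v\<in>V. v = u \<or> v = w}"
    using assms(1) by (simp add: sum.If_cases Int_def)
  also have "{v\<in>V. v = u \<or> v = w} = {u, w}" using u w by auto
  finally have s': "sum d V = sum d' V + 2" using w by simp
  then have sk: "sum d' V = 4 * card V - 6 + 2 * k" using Suc.prems(5) by simp
  \<comment> \<open>At \<open>u\<close> and \<open>w\<close> both sides drop by 2. Elsewhere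
    \<open>2 * d v \<le> d v + d u \<le> sum d V - d w\<close>, and
    \<open>d w \<ge> 2\<close>.\<close>
  have bal: "2 * d' v \<le> sum d' V" if v: "v \<in> V" for v
  proof (cases "v = u \<or> v = w")
    case True
    then show ?thesis using Suc.prems(4) v dd'[of v] s' by force
  next
    case False
    have "sum d {v, u, w} \<le> sum d V" using v u w assms(1) by (intro sum_mono2) auto
    then have "d v + d u + d w \<le> sum d V" using False w by (simp add: add.assoc)
    moreover have "d v \<le> d u" using u v by blast
    ultimately show ?thesis using w2 s' dd'[of v] False by simp
  qed
  \<comment> \<open>If \<open>d w \<ge> 3\<close>, both lowered degrees stay at least 2 and
    \<open>x\<close> remains the exceptional vertex. Otherwise \<open>w\<close> drops to degree 1
    and takes that role.\<close>
  have "\<exists>z\<in>V. 1 \<le> d' z \<and> (\<forall>v\<in>V - {z}. 2 \<le> d' v)"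
  proof (cases "d w \<ge> 3")
    case True
    then have "d u \<ge> 3" using u w by force
    with True Suc.prems show ?thesis by (intro bexI[of _ x]) (auto simp: d'_def)
  next
    case False
    then have w2': "d w = 2" using w2 by simp
    have le2: "\<forall>v\<in>V - {u}. d v \<le> 2" using w w2' by auto
    \<comment> \<open>Balance at \<open>u\<close> leaves at least half the sum, thus at least
      \<open>2 * (card V - 1)\<close>, to the other vertices; as none exceeds 2, all have degree
      exactly 2.\<close>
    have "2 * d u \<le> sum d V" using Suc.prems(4) u by blast
    then have lower: "sum d (V - {u}) \<ge> 2 * (card V - 1)"
      using su Suc.prems(5) assms(2) by simp
    have two: "d v = 2" if v: "v \<in> V - {u}" for v
    proof (rule ccontr)
      assume "d v \<noteq> 2"
      with v le2 have "d v < 2" by force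
      then have "sum d (V - {u}) < (\<Sum>v\<in>V - {u}. 2)"
        using v le2 assms(1) by (intro sum_strict_mono_ex1) auto
      with lower cu show False by simp
    qed
    have "sum d (V - {u}) = (\<Sum>v\<in>V - {u}. 2)" using two by (intro sum.cong) auto
    then have "sum d (V - {u}) = 2 * (card V - 1)" using cu by simp
    then have "d u \<ge> 3" using su Suc.prems(5) assms(2) by simp
    with two w w2' show ?thesis by (intro bexI[of _ w]) (auto simp: d'_def)
  qed
  then obtain z where "z \<in> V" "1 \<le> d' z" "\<forall>v\<in>V - {z}. 2 \<le> d' v" by blast
  then have "two_tree_realizable V d'" using Suc.IH[of z d'] bal sk by blast
  then show ?case using two_tree_realizable_add_edge u(1) w(1,2) dd' by metis
qed

lemma two_tree_realizable_imp:
  assumes "two_tree_realizable {1..n} d"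
  shows "\<exists>(G :: (nat, nat) multigraph) S T. realization G n d \<and>
            spanning_tree G S \<and> spanning_tree G T \<and> card (S \<inter> T) \<le> 1"
proof -
  from assms obtain f :: "nat \<Rightarrow> nat set" and E S T where
    E: "finite E" "\<forall>e\<in>E. f e \<subseteq> {1..n} \<and> card (f e) = 2"
    "\<forall>v\<in>{1..n}. card {e\<in>E. v \<in> f e} = d v"
    and ST: "S \<subseteq> E" "T \<subseteq> E" "leaf_tree f {1..n} S" "leaf_tree f {1..n} T" "card (S \<inter> T) \<le> 1"
    unfolding two_tree_realizable_def by blast
  let ?G = "\<lparr>mverts = {1..n}, medges = E, mends = f\<rparr>"
  have "realization ?G n d" using E by (auto simp: realization_def loopless_multigraph_def mdegree_def)
  moreover have "spanning_tree ?G S" "spanning_tree ?G T"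
    using ST by (auto intro: leaf_tree_spanning_tree)
  ultimately show ?thesis using ST(5) by blast
qed

section \<open>Necessary conditions\<close>

lemma handshake:
  assumes "loopless_multigraph G"
  shows "(\<Sum>v\<in>mverts G. mdegree G v) = 2 * card (medges G)"
proof -
  have fin: "finite (mverts G)" "finite (medges G)"
    and ends: "\<And>e. e \<in> medges G \<Longrightarrow> mends G e \<subseteq> mverts G \<and> card (mends G e) = 2"
    using assms by (auto simp: loopless_multigraph_def)
  have "(\<Sum>v\<in>mverts G. mdegree G v) = (\<Sum>e\<in>medges G. card {v\<in>mverts G. v \<in> mends G e})"
    unfolding mdegree_def using fin
    by (intro sum_multicount_gen[symmetric]) auto
  also have "\<dots> = (\<Sum>e\<in>medges G. 2)"
  proof (rule sum.cong[OF refl])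
    fix e assume "e \<in> medges G"
    moreover from this have "{v\<in>mverts G. v \<in> mends G e} = mends G e" using ends by blast
    ultimately show "card {v\<in>mverts G. v \<in> mends G e} = 2" using ends by simp
  qed
  finally show ?thesis by simp
qed

text \<open>Together the two facts give the balance condition: a degree counts edges, and the sum
  counts every edge twice.\<close>

lemma realization_handshake:
  assumes "realization G n d"
  shows "(\<Sum>i=1..n. d i) = 2 * card (medges G)" "i \<in> {1..n} \<Longrightarrow> d i \<le> card (medges G)"
proof -
  have G: "loopless_multigraph G" "mverts G = {1..n}" "\<forall>i\<in>{1..n}. mdegree G i = d i"
    using assms by (auto simp: realization_def)
  have "(\<Sum>i=1..n. d i) = (\<Sum>i=1..n. mdegree G i)" using G by (intro sum.cong) auto
  with handshake[OF G(1)] G(2) show "(\<Sum>i=1..n. d i) = 2 * card (medges G)" by simp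
  assume "i \<in> {1..n}"
  then have "d i = card {e\<in>medges G. i \<in> mends G e}" using G by (auto simp: mdegree_def)
  also have "\<dots> \<le> card (medges G)" using G(1) by (intro card_mono) (auto simp: loopless_multigraph_def)
  finally show "d i \<le> card (medges G)" .
qed

text \<open>Without an edge leaving \<open>W\<close>, everything reachable from \<open>u\<close>
  stays inside \<open>W\<close>.\<close>

lemma mconnected_crossing_edge:
  assumes "mconnected G" "u \<in> W" "u \<in> mverts G" "v \<in> mverts G" "v \<notin> W"
  shows "\<exists>e\<in>medges G. \<exists>p q. mends G e = {p, q} \<and> p \<in> W \<and> q \<notin> W"
proof (rule ccontr)
  assume no: "\<not> ?thesis"
  have "(u, v) \<in> (madj G)\<^sup>*" using assms by (auto simp: mconnected_def)
  then have "v \<in> W"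
  proof induction
    case (step y z)
    then show ?case using no by (auto simp: madj_def)
  qed (rule assms(2))
  with assms(5) show False by blast
qed

text \<open>Grow a leaf tree inside \<open>G\<close>: while vertices are missing, a crossing edge
  attaches a new leaf. The final tree has one edge fewer than \<open>G\<close> has vertices.\<close>

lemma mconnected_card_edges:
  assumes con: "mconnected G" and fin: "finite (mverts G)" "finite (medges G)"
    and ends: "\<And>e. e \<in> medges G \<Longrightarrow> mends G e \<subseteq> mverts G"
  shows "card (mverts G) \<le> Suc (card (medges G))"
proof -
  have "\<exists>W F. leaf_tree (mends G) W F \<and> W \<subseteq> mverts G \<and> F \<subseteq> medges G \<and> card W = m"
    if "1 \<le> m" "m \<le> card (mverts G)" for m
    using that
  proof (induction m rule: nat_induct_at_least)
    case base
    obtain v where "v \<in> mverts G" using con by (auto simp: mconnected_def)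
    then show ?case by (intro exI[of _ "{v}"] exI[of _ "{}"]) (auto intro: leaf_tree.single)
  next
    case (Suc m)
    then obtain W F where W: "leaf_tree (mends G) W F" "W \<subseteq> mverts G" "F \<subseteq> medges G" "card W = m"
      by auto
    note basic = leaf_tree_basic[OF W(1)]
    have "W \<noteq> mverts G" using W(4) Suc.prems by auto
    then obtain v where v: "v \<in> mverts G" "v \<notin> W" using W by blast
    have "W \<noteq> {}" using W(4) Suc.hyps by auto
    then obtain u where "u \<in> W" by blast
    with mconnected_crossing_edge[OF con, of u W v] v W obtain e p q where
      e: "e \<in> medges G" "mends G e = {p, q}" "p \<in> W" "q \<notin> W" by blast
    have "e \<notin> F" using basic e by auto
    then have "leaf_tree (mends G) (insert q W) (insert e F)"
      using W(1) e by (intro leaf_tree.leaf) auto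
    moreover have "q \<in> mverts G" using ends[OF e(1)] e by auto
    ultimately show ?case using W e basic
      by (intro exI[of _ "insert q W"] exI[of _ "insert e F"]) auto
  qed
  moreover have "1 \<le> card (mverts G)"
    using con fin by (simp add: mconnected_def Suc_le_eq card_gt_0_iff)
  ultimately obtain W F where W: "leaf_tree (mends G) W F" "F \<subseteq> medges G" "card W = card (mverts G)"
    by blast
  have "card F \<le> card (medges G)" using W fin by (simp add: card_mono)
  with leaf_tree_basic(3)[OF W(1)] W(3) show ?thesis by simp
qed

lemma spanning_trees_necessary:
  fixes G :: "(nat, 'e) multigraph"
  assumes "n \<ge> 1" "degree_sequence n d" and real: "realization G n d"
    and S: "spanning_tree G S" and T: "spanning_tree G T" and ST: "card (S \<inter> T) \<le> 1"
  shows "int (\<Sum>i=1..n. d i) \<ge> 4 * (int n - 1) - 2 \<and> (n \<le> 2 \<or> (n > 2 \<and> d (n - 1) \<ge> 2 \<and> d n \<ge> 1))"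
proof -
  have G: "finite (medges G)" "mverts G = {1..n}" "\<forall>i\<in>{1..n}. mdegree G i = d i"
    "\<And>e. e \<in> medges G \<Longrightarrow> mends G e \<subseteq> {1..n} \<and> card (mends G e) = 2"
    using real by (auto simp: realization_def loopless_multigraph_def)
  have tree: "mconnected (G\<lparr>medges := R\<rparr>)" "R \<subseteq> medges G" "n \<le> Suc (card R)"
    if "spanning_tree G R" for R
  proof -
    show c: "mconnected (G\<lparr>medges := R\<rparr>)" and sub: "R \<subseteq> medges G"
      using that by (auto simp: spanning_tree_def mtree_def)
    show "n \<le> Suc (card R)"
      using mconnected_card_edges[OF c] G sub finite_subset[OF sub] by auto
  qed
  have fin: "finite S" "finite T" using tree(2) S T G(1) finite_subset by blast+
  have "card S + card T = card (S \<union> T) + card (S \<inter> T)" using fin by (rule card_Un_Int)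
  moreover have "card (S \<union> T) \<le> card (medges G)" using tree(2) S T G(1) by (intro card_mono) auto
  ultimately have "2 * n \<le> card (medges G) + 3" using ST tree(3)[OF S] tree(3)[OF T] by linarith
  then have sum: "int (\<Sum>i=1..n. d i) \<ge> 4 * (int n - 1) - 2"
    unfolding realization_handshake(1)[OF real] by simp
  have cross: "\<exists>e\<in>R. \<exists>p q. mends G e = {p, q} \<and> p \<in> W \<and> q \<notin> W"
    if "spanning_tree G R" "u \<in> W" "u \<in> {1..n}" "v \<in> {1..n}" "v \<notin> W" for R W u v
    using mconnected_crossing_edge[OF tree(1)[OF that(1)] that(2)] that(3-) G(2) by simp
  have deg2: "d (n - 1) \<ge> 2 \<and> d n \<ge> 1" if n: "n > 2"
  proof -
    have at: "\<exists>e\<in>R. i \<in> mends G e" if "spanning_tree G R" "i \<in> {1..n}" for R i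
    proof -
      define j :: nat where "j = (if i = 1 then 2 else 1)"
      have "j \<in> {1..n}" "j \<noteq> i" using n by (auto simp: j_def)
      with cross[OF that(1), of i "{i}" j] that(2) show ?thesis by auto
    qed
    have d_card: "d i = card {e\<in>medges G. i \<in> mends G e}" if "i \<in> {1..n}" for i
      using G(3) that by (simp add: mdegree_def)
    have pos: "d i \<ge> 1" if i: "i \<in> {1..n}" for i
    proof -
      have "{e\<in>medges G. i \<in> mends G e} \<noteq> {}" using at[OF S i] tree(2)[OF S] by auto
      then show ?thesis using d_card[OF i] G(1) by (simp add: Suc_le_eq card_gt_0_iff)
    qed
    \<comment> \<open>A vertex of degree 1 has only one edge, and both trees need it to reach that
      vertex.\<close>
    have shared: "\<exists>e\<in>S \<inter> T. {e\<in>medges G. i \<in> mends G e} = {e}" if "i \<in> {1..n}" "d i \<le> 1" for i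
    proof -
      have "card {e\<in>medges G. i \<in> mends G e} = 1" using pos[OF that(1)] that d_card by simp
      then obtain e where e: "{e\<in>medges G. i \<in> mends G e} = {e}" by (rule card_1_singletonE)
      have "e \<in> R" if R: "spanning_tree G R" for R
      proof -
        obtain e' where e': "e' \<in> R" "i \<in> mends G e'" using at[OF R \<open>i \<in> {1..n}\<close>] by blast
        then have "e' \<in> {e\<in>medges G. i \<in> mends G e}" using tree(2)[OF R] by blast
        with e e'(1) show ?thesis by simp
      qed
      then have "e \<in> S \<inter> T" using S T by blast
      with e show ?thesis by blast
    qed
    have "d (n - 1) \<ge> 2"
    proof (rule ccontr)
      assume "\<not> ?thesis"
      then have d1: "d (n - 1) \<le> 1" by simp
      have "d n \<le> d (n - 1)" using assms(2) n by (auto simp: degree_sequence_def)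
      with d1 have d2: "d n \<le> 1" by simp
      have n1: "n - 1 \<in> {1..n}" using n by auto
      obtain e where e: "e \<in> S \<inter> T" "{e\<in>medges G. n - 1 \<in> mends G e} = {e}"
        using shared[OF n1 d1] by blast
      obtain e' where e': "e' \<in> S \<inter> T" "{e\<in>medges G. n \<in> mends G e} = {e'}"
        using shared[OF _ d2] n by auto
      \<comment> \<open>The trees have at most one common edge, so the two low vertices lie on the
        same edge and are its two ends.\<close>
      have "e' = e" using ST e(1) e'(1) fin by (metis One_nat_def card_le_Suc0_iff_eq finite_Int)
      then have "e \<in> {e\<in>medges G. n - 1 \<in> mends G e}" "e \<in> {e\<in>medges G. n \<in> mends G e}"
        using e(2) e'(2) by simp_all
      then have "{n - 1, n} \<subseteq> mends G e" "e \<in> medges G" by simp_all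
      moreover have "card {n - 1, n} = 2" using n by simp
      ultimately have ends: "mends G e = {n - 1, n}" using G(4)
        by (metis card_subset_eq card.infinite zero_neq_numeral)
      \<comment> \<open>Vertex 1 lies outside this pair, yet \<open>S\<close> can leave the pair
        only along an edge at \<open>n - 1\<close> or \<open>n\<close>. The only such edge is
        \<open>e\<close>, with both ends inside.\<close>
      have not1: "1 \<notin> {n - 1, n}" using n by auto
      obtain e2 p q where e2: "e2 \<in> S" "mends G e2 = {p, q}" "p \<in> {n - 1, n}" "q \<notin> {n - 1, n}"
        using cross[OF S, of n "{n - 1, n}" 1] n not1 by auto
      then have "e2 \<in> {e\<in>medges G. n - 1 \<in> mends G e} \<or> e2 \<in> {e\<in>medges G. n \<in> mends G e}"
        using tree(2)[OF S] by auto
      then have "e2 = e" using e(2) e'(2) \<open>e' = e\<close> by auto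
      with e2 ends show False by auto
    qed
    with pos n show ?thesis by auto
  qed
  from sum deg2 show ?thesis by (cases "n \<le> 2") auto
qed

section \<open>The equivalence, with the cases n = 1, n = 2 and n at least 3\<close>

theorem theorem5p3:
  fixes n :: nat and d :: "nat \<Rightarrow> nat"
  assumes "n \<ge> 1" and "multigraphical n d"
  shows "(\<exists>(G :: (nat, nat) multigraph) S T. realization G n d \<and>
            spanning_tree G S \<and> spanning_tree G T \<and> card (S \<inter> T) \<le> 1) \<longleftrightarrow>
         (int (\<Sum>i=1..n. d i) \<ge> 4 * (int n - 1) - 2 \<and>
          (n \<le> 2 \<or> (n > 2 \<and> d (n - 1) \<ge> 2 \<and> d n \<ge> 1)))"
    (is "?L \<longleftrightarrow> ?R")
proof
  assume ?L
  then show ?R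
    using spanning_trees_necessary[OF assms(1)] assms(2) unfolding multigraphical_def by blast
next
  assume R: ?R
  obtain H :: "(nat, nat) multigraph" where H: "realization H n d" and mono: "degree_sequence n d"
    using assms(2) by (auto simp: multigraphical_def)
  note hs = realization_handshake[OF H]
  consider "n = 1" | "n = 2" | "n \<ge> 3" using assms(1) by linarith
  then have "two_tree_realizable {1..n} d"
  proof cases
    case 1
    \<comment> \<open>\<open>d 1\<close> is the whole sum, twice the number of edges, yet at most
      that number.\<close>
    with hs have "d 1 = 0" by simp
    with 1 show ?thesis unfolding two_tree_realizable_def
      by (intro exI[of _ "\<lambda>_. {}"] exI[of _ "{}"]) (auto intro: leaf_tree.single)
  next
    case 2
    then have V: "{1..n} = {1, 2}" by auto
    define m where "m = card (medges H)"
    have "d 1 + d 2 = 2 * m" "d 1 \<le> m" "d 2 \<le> m"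
      using hs(1) hs(2)[of 1] hs(2)[of 2] 2 V by (auto simp: m_def)
    \<comment> \<open>Neither degree exceeds half the sum, so they are equal. Then \<open>m\<close>
      parallel edges realize them, and edge \<open>0\<close> alone serves as both trees, which is
      the overlap allowed.\<close>
    then have d: "d 1 = m" "d 2 = m" by auto
    with R V 2 have m: "m \<ge> 1" by auto
    have "leaf_tree (\<lambda>_. {1, 2}) (insert 2 {1 :: nat}) (insert (0 :: nat) {})"
      by (intro leaf_tree.leaf leaf_tree.single) auto
    then have "leaf_tree (\<lambda>_. {1, 2}) {1..n} {0 :: nat}" using V by (simp add: insert_commute)
    with m d V show ?thesis unfolding two_tree_realizable_def
      by (intro exI[of _ "\<lambda>_. {1, 2}"] exI[of _ "{..<m}"] exI[of _ "{0}"]) auto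
  next
    case 3
    \<comment> \<open>Vertex \<open>n\<close> is the exceptional one; the order carries the bound on
      \<open>d (n - 1)\<close> to all others.\<close>
    have dn: "1 \<le> d n" "2 \<le> d (n - 1)" using R 3 by auto
    have "d v \<ge> 2" if "v \<in> {1..n} - {n}" for v
    proof -
      have "d (n - 1) \<le> d v" using mono that 3 by (auto simp: degree_sequence_def)
      with dn show ?thesis by simp
    qed
    moreover have "\<forall>v\<in>{1..n}. 2 * d v \<le> sum d {1..n}" using hs by auto
    \<comment> \<open>Parity: the sum is twice the number of edges and \<open>4 * n - 6\<close> is
      even, so the surplus has the form \<open>2 * k\<close>.\<close>
    moreover have "\<exists>k. sum d {1..n} = 4 * card {1..n} - 6 + 2 * k"
    proof -
      have "2 * n \<le> card (medges H) + 3" using conjunct1[OF R] unfolding hs(1) by simp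
      with 3 show ?thesis using hs(1)
        by (intro exI[of _ "card (medges H) - (2 * n - 3)"]) (simp; linarith)
    qed
    ultimately show ?thesis using two_tree_realizable_sufficient[of "{1..n}" n d] 3 dn(1) by auto
  qed
  then show ?L by (rule two_tree_realizable_imp)
qed

end
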